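(* Let $\alpha\in(0,1)$, $p\in(0,1]$ and $m=\lfloor\alpha n\rfloor$. There exist constants $\rho^*(\alpha,p)>0$ and $c_{11}>0$ such that for all sufficiently large $n$, with probability at least $1-e^{-c_{11}n}$, an $m\times n$ matrix $A$ with i.i.d. $\mathcal N(0,1)$ entries has the property: every $\mathbf x\in\mathbb R^n$ with at most $\rho^*(\alpha,p)n$ nonzero entries is the unique solution of $\min\{\|\mathbf v\|_p^p:A\mathbf v=A\mathbf x\}$.
   Context: $\|\mathbf v\|_p^p=\sum_i|v_i|^p$. *)

theory Defs
  imports "HOL-Probability.Probability"
begin

definition std_gaussian :: "real measure" where
  "std_gaussian = density lborel std_normal_density"

definition gaussian_matrix :: "nat \<Rightarrow> nat \<Rightarrow> (nat \<times> nat \<Rightarrow> real) measure" where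
  "gaussian_matrix m n = (\<Pi>\<^sub>M ij \<in> {..<m} \<times> {..<n}. std_gaussian)"

definition lp_pow :: "real \<Rightarrow> nat \<Rightarrow> (nat \<Rightarrow> real) \<Rightarrow> real" where
  "lp_pow p n v = (\<Sum>i<n. \<bar>v i\<bar> powr p)"

definition mat_vec :: "nat \<Rightarrow> nat \<Rightarrow> (nat \<times> nat \<Rightarrow> real) \<Rightarrow> (nat \<Rightarrow> real) \<Rightarrow> nat \<Rightarrow> real" where
  "mat_vec m n A v = (\<lambda>i. if i < m then (\<Sum>j<n. A (i, j) * v j) else 0)"

definition vecs :: "nat \<Rightarrow> (nat \<Rightarrow> real) set" where
  "vecs n = {v. \<forall>i\<ge>n. v i = 0}"

definition unique_lp_min :: "real \<Rightarrow> nat \<Rightarrow> nat \<Rightarrow> (nat \<times> nat \<Rightarrow> real) \<Rightarrow> (nat \<Rightarrow> real) \<Rightarrow> bool" where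
  "unique_lp_min p m n A x \<longleftrightarrow>
     (\<forall>v \<in> vecs n. mat_vec m n A v = mat_vec m n A x \<longrightarrow> v \<noteq> x \<longrightarrow> lp_pow p n x < lp_pow p n v)"

definition sparse_recovery :: "real \<Rightarrow> real \<Rightarrow> nat \<Rightarrow> nat \<Rightarrow> (nat \<times> nat \<Rightarrow> real) \<Rightarrow> bool" where
  "sparse_recovery p s m n A \<longleftrightarrow>
     (\<forall>x \<in> vecs n. real (card {i \<in> {..<n}. x i \<noteq> 0}) \<le> s \<longrightarrow> unique_lp_min p m n A x)"

end

(*
Two elementary reductions: exact recovery is equivalent to the null space property, namely that
every nonzero z with A z = 0 has less p-mass on any T with at most rho n elements than off T; and
for p <= 1 a failure for p forces a failure for p = 1, on the set carrying the largest p-mass.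

Scale a failing z so that its l1 norm is N = gamma n and round its entries towards zero, z = v - e
with v integral and norm(v)_1 <= N. Half of the l1 norm of z sits on N / L coordinates, so
norm(z)_2^2 >= N L / 4, whereas norm(e)_2^2 <= N; for large L this forces norm(v)_2^2 >= N (L / 8 - 1).
Now A v = A e, and two events of exponentially small failure probability give a contradiction:
  - norm(A w)^2 <= 8 n norm(w)_2^2 for the 3^n vectors w with entries in {-1, 0, 1}; peeling e into
    such vectors gives norm(A e)^2 <= 8 n N.
  - norm(A v)^2 >= const n norm(v)_2^2 for all integral v with norm(v)_1 <= N; for small gamma there
    are only e^(small n) of these.
*)
theory Submission
  imports Defs
begin

section \<open>Gaussian matrices: exponential moments and tail bounds for the squared norm of the
  image\<close>

text \<open>The exponential factor turns the centred normal density of deviation \<open>r\<close>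
  into \<sigma> times that of deviation \<sigma> \<open>r\<close>. Parametrising the exponent by
  \<sigma> covers both signs: \<sigma> > 1 serves the upper tail, \<sigma> < 1 the lower
  tail.\<close>

lemma nn_integral_exp_square_normal:
  assumes Y: "distributed M lborel Y (normal_density 0 r)" and r: "0 < r" and \<sigma>: "0 < \<sigma>"
  shows "(\<integral>\<^sup>+\<omega>. ennreal (exp ((1 - 1 / \<sigma>\<^sup>2) / 2 * (Y \<omega> / r)\<^sup>2)) \<partial>M) = ennreal \<sigma>"
proof -
  have eq: "normal_density 0 r x * exp ((1 - 1 / \<sigma>\<^sup>2) / 2 * (x / r)\<^sup>2) = \<sigma> * normal_density 0 (\<sigma> * r) x" for x
  proof -
    have s: "sqrt (2 * pi * (\<sigma> * r)\<^sup>2) = \<sigma> * sqrt (2 * pi * r\<^sup>2)"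
      using r \<sigma> by (simp add: real_sqrt_mult)
    have "- (x - 0)\<^sup>2 / (2 * r\<^sup>2) + (1 - 1 / \<sigma>\<^sup>2) / 2 * (x / r)\<^sup>2 = - (x - 0)\<^sup>2 / (2 * (\<sigma> * r)\<^sup>2)"
      using r \<sigma> by (simp add: field_simps)
    then have "exp (- (x - 0)\<^sup>2 / (2 * r\<^sup>2)) * exp ((1 - 1 / \<sigma>\<^sup>2) / 2 * (x / r)\<^sup>2)
        = exp (- (x - 0)\<^sup>2 / (2 * (\<sigma> * r)\<^sup>2))"
      by (simp only: exp_add[symmetric])
    then show ?thesis
      unfolding normal_density_def s using \<sigma> by simp
  qed
  have "(\<integral>\<^sup>+\<omega>. ennreal (exp ((1 - 1 / \<sigma>\<^sup>2) / 2 * (Y \<omega> / r)\<^sup>2)) \<partial>M)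
      = (\<integral>\<^sup>+x. ennreal (normal_density 0 r x) * ennreal (exp ((1 - 1 / \<sigma>\<^sup>2) / 2 * (x / r)\<^sup>2)) \<partial>lborel)"
    by (intro distributed_nn_integral[OF Y, symmetric]) measurable
  also have "\<dots> = (\<integral>\<^sup>+x. ennreal \<sigma> * ennreal (normal_density 0 (\<sigma> * r) x) \<partial>lborel)"
    using \<sigma> by (simp only: ennreal_mult'[symmetric] normal_density_nonneg exp_ge_zero eq less_imp_le)
  also have "\<dots> = ennreal \<sigma> * (\<integral>\<^sup>+x. ennreal (normal_density 0 (\<sigma> * r) x) \<partial>lborel)"
    by (intro nn_integral_cmult) measurable
  also have "(\<integral>\<^sup>+x. ennreal (normal_density 0 (\<sigma> * r) x) \<partial>lborel) = 1"
    using r \<sigma> prob_space.emeasure_space_1[OF prob_space_normal_density[of "\<sigma> * r" 0]]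
    by (simp add: emeasure_density)
  finally show ?thesis by simp
qed

lemma prob_space_std_gaussian: "prob_space std_gaussian"
  unfolding std_gaussian_def by (rule prob_space_normal_density) simp

lemma sets_std_gaussian [measurable_cong, simp]: "sets std_gaussian = sets borel"
  by (simp add: std_gaussian_def)

lemma space_std_gaussian [simp]: "space std_gaussian = UNIV"
  by (simp add: std_gaussian_def)

lemma prob_space_gaussian_matrix: "prob_space (gaussian_matrix m n)"
  unfolding gaussian_matrix_def by (intro prob_space_PiM prob_space_std_gaussian)

lemma measurable_gaussian_entry [measurable (raw)]:
  "i < m \<Longrightarrow> j < n \<Longrightarrow> (\<lambda>A. A (i, j)) \<in> borel_measurable (gaussian_matrix m n)"
  unfolding gaussian_matrix_def using measurable_component_singleton[of "(i,j)" "{..<m} \<times> {..<n}" "\<lambda>_. std_gaussian"]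
  by (simp add: measurable_cong_sets[OF refl sets_std_gaussian])

lemma indep_gaussian_entries:
  "prob_space.indep_vars (gaussian_matrix m n) (\<lambda>_. borel) (\<lambda>ij A. A ij) ({..<m} \<times> {..<n})"
proof -
  interpret prob_space "gaussian_matrix m n" by (rule prob_space_gaussian_matrix)
  show ?thesis
  \<comment> \<open>Describing independence through the product law requires a nonempty index set,
    so \<open>m = 0\<close> or \<open>n = 0\<close> is treated apart.\<close>
  proof (cases "{..<m} \<times> {..<n} = {}")
    case True
    then have "{..<m} \<times> {..<n} = {}" .
    then show ?thesis by (simp only: indep_vars_def indep_sets_def) auto
  next
    case False
    have sets: "sets (PiM ({..<m} \<times> {..<n}) (\<lambda>_. borel)) = sets (gaussian_matrix m n)"
      unfolding gaussian_matrix_def by (intro sets_PiM_cong) simp_all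
    have "distr (gaussian_matrix m n) (PiM ({..<m} \<times> {..<n}) (\<lambda>_. borel)) (\<lambda>A. \<lambda>ij\<in>{..<m} \<times> {..<n}. A ij)
        = distr (gaussian_matrix m n) (gaussian_matrix m n) (\<lambda>A. A)"
      by (intro distr_cong sets) (auto simp: gaussian_matrix_def space_PiM intro!: PiE_restrict)
    also have "\<dots> = gaussian_matrix m n" by (simp add: distr_id)
    also have "\<dots> = PiM ({..<m} \<times> {..<n}) (\<lambda>ij. distr (gaussian_matrix m n) borel (\<lambda>A. A ij))"
    proof -
      have "distr (gaussian_matrix m n) borel (\<lambda>A. A ij) = std_gaussian" if "ij \<in> {..<m} \<times> {..<n}" for ij
        using distr_PiM_component[of "{..<m} \<times> {..<n}" "\<lambda>_. std_gaussian" ij] that prob_space_std_gaussian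
        unfolding gaussian_matrix_def by (metis distr_cong sets_std_gaussian)
      then show ?thesis
        by (simp add: gaussian_matrix_def cong: PiM_cong)
    qed
    finally show ?thesis
      using False by (subst indep_vars_iff_distr_eq_PiM') auto
  qed
qed

lemma distributed_gaussian_entry:
  assumes "i < m" "j < n"
  shows "distributed (gaussian_matrix m n) lborel (\<lambda>A. A (i, j)) std_normal_density"
proof -
  have "distr (gaussian_matrix m n) lborel (\<lambda>A. A (i, j)) = std_gaussian"
    using distr_PiM_component[of "{..<m} \<times> {..<n}" "\<lambda>_. std_gaussian" "(i, j)"] assms prob_space_std_gaussian
    unfolding gaussian_matrix_def by (metis distr_cong sets_std_gaussian sets_lborel SigmaI lessThan_iff)
  then show ?thesis
    unfolding distributed_def using assms
    by (auto simp: std_gaussian_def)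
qed

lemma distributed_gaussian_row:
  assumes i: "i < m" and v: "0 < (\<Sum>j<n. (v j)\<^sup>2)"
  shows "distributed (gaussian_matrix m n) lborel (\<lambda>A. \<Sum>j<n. A (i, j) * v j)
           (normal_density 0 (sqrt (\<Sum>j<n. (v j)\<^sup>2)))"
proof -
  interpret prob_space "gaussian_matrix m n" by (rule prob_space_gaussian_matrix)
  \<comment> \<open>Zero coefficients are dropped: the corresponding summand is constant and has no
    normal density.\<close>
  define J where "J = {j\<in>{..<n}. v j \<noteq> 0}"
  have J: "finite J" "J \<subseteq> {..<n}" by (auto simp: J_def)
  have ne: "J \<noteq> {}"
  proof
    assume "J = {}"
    then have "(\<Sum>j<n. (v j)\<^sup>2) = 0" by (intro sum.neutral) (auto simp: J_def)
    with v show False by simp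
  qed
  \<comment> \<open>Independence of the whole family is restricted to the singleton blocks
    \<open>{(i, j)}\<close> of one row.\<close>
  have "indep_vars (\<lambda>j. PiM {(i, j)} (\<lambda>_. borel)) (\<lambda>j A. restrict (\<lambda>ij. A ij) {(i, j)}) J"
    using i J by (intro indep_vars_restrict[OF indep_gaussian_entries]) (auto simp: disjoint_family_on_def)
  then have "indep_vars (\<lambda>_. borel) (\<lambda>j A. restrict A {(i, j)} (i, j) * v j) J"
    by (rule indep_vars_compose2[where Y = "\<lambda>j r. r (i, j) * v j"])
       (auto intro!: borel_measurable_times measurable_component_singleton)
  then have ind: "indep_vars (\<lambda>_. borel) (\<lambda>j A. A (i, j) * v j) J" by simp
  have "distributed (gaussian_matrix m n) lborel (\<lambda>A. A (i, j) * v j) (normal_density 0 \<bar>v j\<bar>)" if "j \<in> J" for j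
    using normal_density_affine[OF distributed_gaussian_entry[of i m j n], of "v j" 0] that i
    by (simp add: J_def mult.commute)
  then have "distributed (gaussian_matrix m n) lborel (\<lambda>A. \<Sum>j\<in>J. A (i, j) * v j)
           (normal_density (\<Sum>j\<in>J. 0) (sqrt (\<Sum>j\<in>J. \<bar>v j\<bar>\<^sup>2)))"
    by (intro sum_indep_normal J ne ind) (auto simp: J_def)
  moreover have "(\<Sum>j\<in>J. A (i, j) * v j) = (\<Sum>j<n. A (i, j) * v j)" for A :: "nat \<times> nat \<Rightarrow> real"
    using J by (intro sum.mono_neutral_left) (auto simp: J_def)
  moreover have "(\<Sum>j\<in>J. \<bar>v j\<bar>\<^sup>2) = (\<Sum>j<n. (v j)\<^sup>2)"
    using J by (simp, intro sum.mono_neutral_left) (auto simp: J_def)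
  ultimately show ?thesis by simp
qed

lemma indep_gaussian_rows:
  "prob_space.indep_vars (gaussian_matrix m n) (\<lambda>_. borel) (\<lambda>i A. \<Sum>j<n. A (i, j) * v j) {..<m}"
proof -
  interpret prob_space "gaussian_matrix m n" by (rule prob_space_gaussian_matrix)
  have "indep_vars (\<lambda>i. PiM ({i} \<times> {..<n}) (\<lambda>_. borel)) (\<lambda>i A. restrict (\<lambda>ij. A ij) ({i} \<times> {..<n})) {..<m}"
    by (intro indep_vars_restrict[OF indep_gaussian_entries]) (auto simp: disjoint_family_on_def)
  then have "indep_vars (\<lambda>_. borel) (\<lambda>i A. \<Sum>j<n. restrict A ({i} \<times> {..<n}) (i, j) * v j) {..<m}"
    by (rule indep_vars_compose2[where Y = "\<lambda>i r. \<Sum>j<n. r (i, j) * v j"]) (auto intro!: borel_measurable_sum borel_measurable_times measurable_component_singleton)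
  then show ?thesis by simp
qed

text \<open>This is the squared Euclidean norm of A v. It reads \<open>v\<close> only below
  \<open>n\<close>, so \<open>v\<close> may be arbitrary elsewhere.\<close>

definition quad :: "nat \<Rightarrow> nat \<Rightarrow> (nat \<times> nat \<Rightarrow> real) \<Rightarrow> (nat \<Rightarrow> real) \<Rightarrow> real" where
  "quad m n A v = (\<Sum>i<m. (\<Sum>j<n. A (i, j) * v j)\<^sup>2)"

lemma measurable_quad [measurable]: "(\<lambda>A. quad m n A v) \<in> borel_measurable (gaussian_matrix m n)"
  unfolding quad_def by measurable

text \<open>The rows are independent and each row sum is normal with variance the squared norm of
  \<open>v\<close>, so the integral splits into \<open>m\<close> one-dimensional ones, each equal to
  \<sigma>.\<close>

lemma nn_integral_exp_quad:
  assumes v: "0 < (\<Sum>j<n. (v j)\<^sup>2)" and \<sigma>: "0 < \<sigma>"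
  shows "(\<integral>\<^sup>+A. ennreal (exp ((1 - 1 / \<sigma>\<^sup>2) / 2 * (quad m n A v / (\<Sum>j<n. (v j)\<^sup>2)))) \<partial>gaussian_matrix m n) = ennreal (\<sigma> ^ m)"
proof -
  interpret prob_space "gaussian_matrix m n" by (rule prob_space_gaussian_matrix)
  define r where "r = sqrt (\<Sum>j<n. (v j)\<^sup>2)"
  have r: "0 < r" "r\<^sup>2 = (\<Sum>j<n. (v j)\<^sup>2)" using v by (simp_all add: r_def)
  define a where "a = (1 - 1 / \<sigma>\<^sup>2) / 2"
  have "ennreal (exp (a * (quad m n A v / (\<Sum>j<n. (v j)\<^sup>2))))
      = (\<Prod>i<m. ennreal (exp (a * ((\<Sum>j<n. A (i, j) * v j) / r)\<^sup>2)))" for A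
    by (simp add: quad_def prod_ennreal power_divide r(2) flip: exp_sum sum_divide_distrib sum_distrib_left)
  then have "(\<integral>\<^sup>+A. ennreal (exp (a * (quad m n A v / (\<Sum>j<n. (v j)\<^sup>2)))) \<partial>gaussian_matrix m n)
     = (\<integral>\<^sup>+A. (\<Prod>i<m. ennreal (exp (a * ((\<Sum>j<n. A (i, j) * v j) / r)\<^sup>2))) \<partial>gaussian_matrix m n)"
    by simp
  also have "\<dots> = (\<Prod>i<m. \<integral>\<^sup>+A. ennreal (exp (a * ((\<Sum>j<n. A (i, j) * v j) / r)\<^sup>2)) \<partial>gaussian_matrix m n)"
    by (intro indep_vars_nn_integral indep_vars_compose2[OF indep_gaussian_rows, where Y = "\<lambda>i y. ennreal (exp (a * (y / r)\<^sup>2))"]) auto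
  also have "\<dots> = (\<Prod>i<m. ennreal \<sigma>)"
    unfolding a_def using r \<sigma> v
    by (intro prod.cong refl nn_integral_exp_square_normal) (auto simp: r_def intro!: distributed_gaussian_row)
  also have "\<dots> = ennreal (\<sigma> ^ m)" using \<sigma> by (simp add: ennreal_power)
  finally show ?thesis by (simp add: a_def)
qed

text \<open>Markov's inequality for the exponential moment. The factor \<open>a\<close> stays on
  both sides of the event so that its sign selects the tail: upper for \<sigma> > 1, lower for
  \<sigma> < 1.\<close>

lemma prob_quad_chernoff:
  assumes v: "0 < (\<Sum>j<n. (v j)\<^sup>2)" and \<sigma>: "0 < \<sigma>" and a: "a = (1 - 1 / \<sigma>\<^sup>2) / 2"
  shows "measure (gaussian_matrix m n) {A \<in> space (gaussian_matrix m n). a * t * (\<Sum>j<n. (v j)\<^sup>2) \<le> a * quad m n A v}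
    \<le> exp (- a * t) * \<sigma> ^ m"
proof -
  interpret prob_space "gaussian_matrix m n" by (rule prob_space_gaussian_matrix)
  let ?M = "gaussian_matrix m n" and ?S = "\<Sum>j<n. (v j)\<^sup>2"
  have "emeasure ?M {A \<in> space ?M. a * t * ?S \<le> a * quad m n A v}
      \<le> emeasure ?M {A \<in> space ?M. 1 \<le> ennreal (exp (- a * t)) * ennreal (exp (a * (quad m n A v / ?S)))}"
  proof (intro emeasure_mono subsetI CollectI conjI; (elim CollectE conjE)?)
    fix A assume "a * t * ?S \<le> a * quad m n A v"
    then have "0 \<le> - a * t + a * (quad m n A v / ?S)" using v by (simp add: field_simps)
    then show "1 \<le> ennreal (exp (- a * t)) * ennreal (exp (a * (quad m n A v / ?S)))"
      by (simp add: ennreal_mult[symmetric] exp_add[symmetric])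
  qed auto
  also have "\<dots> \<le> ennreal (exp (- a * t)) * (\<integral>\<^sup>+A. ennreal (exp (a * (quad m n A v / ?S))) * indicator (space ?M) A \<partial>?M)"
    by (intro nn_integral_Markov_inequality) auto
  also have "(\<integral>\<^sup>+A. ennreal (exp (a * (quad m n A v / ?S))) * indicator (space ?M) A \<partial>?M)
      = (\<integral>\<^sup>+A. ennreal (exp (a * (quad m n A v / ?S))) \<partial>?M)"
    by (intro nn_integral_cong) simp
  also have "\<dots> = ennreal (\<sigma> ^ m)"
    unfolding a by (rule nn_integral_exp_quad[OF v \<sigma>])
  finally show ?thesis
    using \<sigma> by (simp add: emeasure_eq_measure ennreal_mult[symmetric])
qed

section \<open>Compactness, and measurability of the existence of a zero\<close>

text \<open>The uncountable union over \<open>K\<close> becomes countable: as the infimum over \<open>K\<close> is attained, a zero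
  exists iff the values on a countable dense subset come arbitrarily close to 0.\<close>

lemma measurable_ex_zero_compact:
  fixes K :: "'b :: {metric_space, second_countable_topology} set" and g :: "'a \<Rightarrow> 'b \<Rightarrow> real"
  assumes K: "compact K"
    and cont: "\<And>A. A \<in> space M \<Longrightarrow> continuous_on K (g A)"
    and nonneg: "\<And>A z. A \<in> space M \<Longrightarrow> z \<in> K \<Longrightarrow> 0 \<le> g A z"
    and meas: "\<And>z. z \<in> K \<Longrightarrow> (\<lambda>A. g A z) \<in> borel_measurable M"
  shows "{A \<in> space M. \<exists>z\<in>K. g A z = 0} \<in> sets M"
proof -
  obtain D where D: "countable D" "D \<subseteq> K" "K \<subseteq> closure D"
    using separable by blast
  have "{A \<in> space M. \<exists>z\<in>K. g A z = 0} = (\<Inter>k::nat. \<Union>z\<in>D. {A \<in> space M. g A z < 1 / real (Suc k)})"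
  proof (intro set_eqI iffI)
    fix A assume "A \<in> {A \<in> space M. \<exists>z\<in>K. g A z = 0}"
    then obtain z where A: "A \<in> space M" and z: "z \<in> K" "g A z = 0" by auto
    have "\<exists>d\<in>D. g A d < 1 / real (Suc k)" for k
    proof -
      obtain \<delta> where \<delta>: "\<delta> > 0" "\<And>y. y \<in> K \<Longrightarrow> dist y z < \<delta> \<Longrightarrow> dist (g A y) (g A z) < 1 / real (Suc k)"
        using cont[OF A] z(1) unfolding continuous_on_iff by (metis of_nat_0_less_iff zero_less_Suc zero_less_divide_1_iff)
      obtain d where d: "d \<in> D" "dist d z < \<delta>"
        using D(3) z(1) \<delta>(1) closure_approachable by blast
      with \<delta>(2)[of d] D(2) z(2) have "\<bar>g A d\<bar> < 1 / real (Suc k)" by (auto simp: dist_real_def)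
      with d show ?thesis by (intro bexI[of _ d]) auto
    qed
    with A show "A \<in> (\<Inter>k::nat. \<Union>z\<in>D. {A \<in> space M. g A z < 1 / real (Suc k)})" by auto
  next
    fix A assume "A \<in> (\<Inter>k::nat. \<Union>z\<in>D. {A \<in> space M. g A z < 1 / real (Suc k)})"
    then have A: "A \<in> space M" and *: "\<exists>z\<in>D. g A z < 1 / real (Suc k)" for k by auto
    from *[of 0] D(2) have "K \<noteq> {}" by auto
    then obtain z where z: "z \<in> K" "\<And>y. y \<in> K \<Longrightarrow> g A z \<le> g A y"
      using continuous_attains_inf[OF K _ cont[OF A]] by blast
    have "g A z \<le> 0"
    proof (rule field_le_epsilon)
      fix e :: real assume "e > 0"
      then obtain k where "1 / real (Suc k) < e" using nat_approx_posE by metis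
      with *[of k] z(2) D(2) show "g A z \<le> 0 + e" by force
    qed
    with nonneg[OF A z(1)] z(1) A show "A \<in> {A \<in> space M. \<exists>z\<in>K. g A z = 0}" by auto
  qed
  also have "\<dots> \<in> sets M"
  proof -
    have "{A \<in> space M. g A z < 1 / real (Suc k)} \<in> sets M" if "z \<in> D" for z k
    proof -
      from D(2) meas that have [measurable]: "(\<lambda>A. g A z) \<in> borel_measurable M" by auto
      show ?thesis by measurable
    qed
    then have "(\<Union>z\<in>D. {A \<in> space M. g A z < 1 / real (Suc k)}) \<in> sets M" for k
      by (intro sets.countable_UN' D) auto
    then show ?thesis by (intro sets.countable_INT') (auto simp del: of_nat_Suc)
  qed
  finally show ?thesis .
qed

text \<open>Functions on the naturals carry the product topology. By Tychonoff the product of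
  intervals [-1, 1] below \<open>n\<close> and of {0} beyond is compact, and the sphere is a closed
  part of it.\<close>

lemma compact_vecs_l1_sphere: "compact {z \<in> vecs n. (\<Sum>i<n. \<bar>z i\<bar>) = (1::real)}"
proof -
  have "compact (PiE UNIV (\<lambda>i. if i < n then {-1..1::real} else {0}))"
    using compactin_PiE[of "\<lambda>_. euclidean" UNIV "\<lambda>i. if i < n then {-1..1::real} else {0}"]
    by (simp add: euclidean_product_topology)
  moreover have "closed {z::nat \<Rightarrow> real. (\<Sum>i<n. \<bar>z i\<bar>) = 1}"
    by (intro closed_Collect_eq continuous_intros continuous_on_product_coordinates)
  ultimately have "compact (PiE UNIV (\<lambda>i. if i < n then {-1..1::real} else {0}) \<inter> {z. (\<Sum>i<n. \<bar>z i\<bar>) = 1})"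
    by (intro compact_Int_closed)
  also have "PiE UNIV (\<lambda>i. if i < n then {-1..1::real} else {0}) \<inter> {z. (\<Sum>i<n. \<bar>z i\<bar>) = 1}
     = {z \<in> vecs n. (\<Sum>i<n. \<bar>z i\<bar>) = 1}" (is "?L = ?R")
  proof (intro equalityI subsetI)
    fix z assume "z \<in> ?L"
    then have box: "z \<in> PiE UNIV (\<lambda>i. if i < n then {-1..1} else {0})" and sum: "(\<Sum>i<n. \<bar>z i\<bar>) = 1"
      by simp_all
    have "z i = 0" if "n \<le> i" for i using PiE_mem[OF box, of i] that by simp
    with sum show "z \<in> ?R" by (simp add: vecs_def)
  next
    fix z assume z: "z \<in> ?R"
    have "z i \<in> (if i < n then {-1..1} else {0})" for i
    proof (cases "i < n")
      case True
      then have "\<bar>z i\<bar> \<le> 1"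
        using member_le_sum[of i "{..<n}" "\<lambda>i. \<bar>z i\<bar>"] z by simp
      with True show ?thesis by (simp add: abs_le_iff)
    next
      case False
      with z show ?thesis by (simp add: vecs_def)
    qed
    with z show "z \<in> ?L" by (simp add: PiE_UNIV_domain)
  qed
  finally show ?thesis .
qed

section \<open>The null space property, its measurability, and the reduction from p to 1\<close>

text \<open>After division by |a| + |b| both moduli lie in [0, 1], where x is at most its p-th
  power, and they add up to 1.\<close>

lemma powr_triangle:
  fixes a b p :: real
  assumes "0 < p" "p \<le> 1"
  shows "\<bar>a + b\<bar> powr p \<le> \<bar>a\<bar> powr p + \<bar>b\<bar> powr p"
proof (cases "a = 0 \<and> b = 0")
  case False
  define s where "s = \<bar>a\<bar> + \<bar>b\<bar>"
  have s: "s > 0" using False by (auto simp: s_def)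
  have le: "x / s \<le> (x / s) powr p" if "0 \<le> x" "x \<le> s" for x
  proof (cases "x = 0")
    case False
    then show ?thesis using powr_mono'[of p 1 "x / s"] assms that s by simp
  qed simp
  have "1 = \<bar>a\<bar> / s + \<bar>b\<bar> / s" using s by (simp add: s_def add_divide_distrib[symmetric])
  also have "\<dots> \<le> (\<bar>a\<bar> / s) powr p + (\<bar>b\<bar> / s) powr p"
    by (intro add_mono le) (auto simp: s_def)
  also have "\<dots> = (\<bar>a\<bar> powr p + \<bar>b\<bar> powr p) / s powr p"
    using s by (simp add: powr_divide add_divide_distrib)
  finally have "s powr p \<le> \<bar>a\<bar> powr p + \<bar>b\<bar> powr p" using s by (simp add: field_simps)
  moreover have "\<bar>a + b\<bar> powr p \<le> s powr p"
    using assms by (intro powr_mono2) (auto simp: s_def)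
  ultimately show ?thesis by linarith
qed simp

text \<open>For z in the kernel, minus the part of z on T and the part of z off T have the same
  image, so recovery of the former compares the two masses. Conversely, take z = v - x and let T be
  the support of x: off T the vectors v and z agree, and on T the p-triangle inequality bounds the
  loss.\<close>

lemma sparse_recovery_iff_null_space_property:
  assumes p: "0 < p" "p \<le> 1"
  shows "sparse_recovery p s m n A \<longleftrightarrow>
    (\<forall>T \<subseteq> {..<n}. real (card T) \<le> s \<longrightarrow>
      (\<forall>z \<in> vecs n. z \<noteq> (\<lambda>_. 0) \<longrightarrow> (\<forall>i<m. (\<Sum>j<n. A (i, j) * z j) = 0) \<longrightarrow>
         (\<Sum>i\<in>T. \<bar>z i\<bar> powr p) < (\<Sum>i\<in>{..<n} - T. \<bar>z i\<bar> powr p)))"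
    (is "_ \<longleftrightarrow> ?nsp")
proof
  assume rec: "sparse_recovery p s m n A"
  show ?nsp
  proof (intro allI impI ballI)
    fix T z assume T: "T \<subseteq> {..<n}" "real (card T) \<le> s" and z: "z \<in> vecs n" "z \<noteq> (\<lambda>_. 0)"
      and Az: "\<forall>i<m. (\<Sum>j<n. A (i, j) * z j) = 0"
    define x v where "x = (\<lambda>i. if i \<in> T then - z i else 0)" and "v = (\<lambda>i. if i \<in> T then 0 else z i)"
    have fin: "finite T" using T finite_subset by blast
    have "card {i \<in> {..<n}. x i \<noteq> 0} \<le> card T"
      by (intro card_mono fin) (auto simp: x_def split: if_splits)
    then have "real (card {i \<in> {..<n}. x i \<noteq> 0}) \<le> s" using T(2) by linarith
    moreover have "x \<in> vecs n" "v \<in> vecs n" using z T by (auto simp: vecs_def x_def v_def)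
    moreover have "v \<noteq> x"
    proof -
      obtain i where "z i \<noteq> 0" using z(2) by auto
      then have "v i \<noteq> x i" by (simp add: x_def v_def)
      then show ?thesis by auto
    qed
    moreover have "mat_vec m n A v = mat_vec m n A x"
    proof -
      have "(\<Sum>j<n. A (i, j) * v j) - (\<Sum>j<n. A (i, j) * x j) = (\<Sum>j<n. A (i, j) * z j)" for i
        unfolding sum_subtractf[symmetric] by (intro sum.cong) (auto simp: x_def v_def)
      then have "(\<Sum>j<n. A (i, j) * v j) = (\<Sum>j<n. A (i, j) * x j)" if "i < m" for i
        using Az that by (metis eq_iff_diff_eq_0)
      then show ?thesis by (auto simp: mat_vec_def)
    qed
    ultimately have "lp_pow p n x < lp_pow p n v"
      using rec unfolding sparse_recovery_def unique_lp_min_def by blast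
    moreover have "lp_pow p n x = (\<Sum>i\<in>T. \<bar>z i\<bar> powr p)"
      unfolding lp_pow_def using T by (intro sum.mono_neutral_cong_right) (auto simp: x_def)
    moreover have "lp_pow p n v = (\<Sum>i\<in>{..<n} - T. \<bar>z i\<bar> powr p)"
      unfolding lp_pow_def using T by (intro sum.mono_neutral_cong_right) (auto simp: v_def)
    ultimately show "(\<Sum>i\<in>T. \<bar>z i\<bar> powr p) < (\<Sum>i\<in>{..<n} - T. \<bar>z i\<bar> powr p)" by simp
  qed
next
  assume nsp: ?nsp
  show "sparse_recovery p s m n A"
    unfolding sparse_recovery_def unique_lp_min_def
  proof (intro ballI impI)
    fix x v assume x: "x \<in> vecs n" "real (card {i \<in> {..<n}. x i \<noteq> 0}) \<le> s"
      and v: "v \<in> vecs n" "mat_vec m n A v = mat_vec m n A x" "v \<noteq> x"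
    define T z where "T = {i \<in> {..<n}. x i \<noteq> 0}" and "z = (\<lambda>i. v i - x i)"
    have T: "T \<subseteq> {..<n}" "real (card T) \<le> s" using x by (auto simp: T_def)
    have z: "z \<in> vecs n" "z \<noteq> (\<lambda>_. 0)" using x v by (auto simp: vecs_def z_def fun_eq_iff)
    have Az: "\<forall>i<m. (\<Sum>j<n. A (i, j) * z j) = 0"
    proof (intro allI impI)
      fix i assume "i < m"
      then show "(\<Sum>j<n. A (i, j) * z j) = 0"
        using fun_cong[OF v(2), of i] by (simp add: mat_vec_def z_def right_diff_distrib sum_subtractf)
    qed
    have lt: "(\<Sum>i\<in>T. \<bar>z i\<bar> powr p) < (\<Sum>i\<in>{..<n} - T. \<bar>z i\<bar> powr p)"
      using nsp T z Az by blast
    have split: "lp_pow p n y = (\<Sum>i\<in>{..<n} - T. \<bar>y i\<bar> powr p) + (\<Sum>i\<in>T. \<bar>y i\<bar> powr p)" for y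
      unfolding lp_pow_def by (intro sum.subset_diff T) simp
    have "(\<Sum>i\<in>T. \<bar>x i\<bar> powr p) \<le> (\<Sum>i\<in>T. \<bar>v i\<bar> powr p + \<bar>z i\<bar> powr p)"
      using powr_triangle[OF p, of "v i" "- z i" for i] by (intro sum_mono) (simp add: z_def abs_minus_commute)
    moreover have "(\<Sum>i\<in>{..<n} - T. \<bar>x i\<bar> powr p) = 0" by (intro sum.neutral) (auto simp: T_def)
    moreover have "(\<Sum>i\<in>{..<n} - T. \<bar>v i\<bar> powr p) = (\<Sum>i\<in>{..<n} - T. \<bar>z i\<bar> powr p)"
      by (intro sum.cong) (auto simp: T_def z_def)
    ultimately show "lp_pow p n x < lp_pow p n v"
      using lt unfolding split by (simp add: sum.distrib)
  qed
qed

text \<open>All conditions on z are invariant under positive scaling, so z may be taken on the l1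
  sphere. There the mass inequality cuts out a compact set, and the kernel condition becomes a zero
  of a continuous nonnegative function.\<close>

lemma measurable_null_space_failure:
  fixes M :: "(nat \<times> nat \<Rightarrow> real) measure"
  assumes "0 < p" and T: "T \<subseteq> {..<n}"
    and meas: "\<And>i j. i < m \<Longrightarrow> j < n \<Longrightarrow> (\<lambda>A. A (i, j)) \<in> borel_measurable M"
  shows "{A \<in> space M. \<exists>z \<in> vecs n. z \<noteq> (\<lambda>_. 0) \<and> (\<forall>i<m. (\<Sum>j<n. A (i, j) * z j) = (0::real)) \<and>
         (\<Sum>i\<in>{..<n} - T. \<bar>z i\<bar> powr p) \<le> (\<Sum>i\<in>T. \<bar>z i\<bar> powr p)} \<in> sets M"
proof -
  define K where "K = {z \<in> vecs n. (\<Sum>i<n. \<bar>z i\<bar>) = (1::real)} \<inter>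
     {z. (\<Sum>i\<in>{..<n} - T. \<bar>z i\<bar> powr p) \<le> (\<Sum>i\<in>T. \<bar>z i\<bar> powr p)}"
  \<comment> \<open>Entries may vanish, and continuity of \<open>powr p\<close> at 0 is where
    positivity of p enters.\<close>
  have "closed {z :: nat \<Rightarrow> real. (\<Sum>i\<in>{..<n} - T. \<bar>z i\<bar> powr p) \<le> (\<Sum>i\<in>T. \<bar>z i\<bar> powr p)}"
    using \<open>0 < p\<close> by (intro closed_Collect_le continuous_on_sum continuous_on_powr' continuous_intros continuous_on_product_coordinates) auto
  then have K: "compact K" unfolding K_def by (intro compact_Int_closed compact_vecs_l1_sphere)
  define g where "g = (\<lambda>(A :: nat \<times> nat \<Rightarrow> real) z. \<Sum>i<m. \<bar>\<Sum>j<n. A (i, j) * z j\<bar>)"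
  have g0: "g A z = 0 \<longleftrightarrow> (\<forall>i<m. (\<Sum>j<n. A (i, j) * z j) = 0)" for A z
    unfolding g_def by (subst sum_nonneg_eq_0_iff) auto
  have "{A \<in> space M. \<exists>z\<in>K. g A z = 0} \<in> sets M"
  proof (rule measurable_ex_zero_compact[OF K])
    show "continuous_on K (g A)" for A
      unfolding g_def
      by (rule continuous_on_subset[OF _ subset_UNIV]) (intro continuous_intros continuous_on_product_coordinates)
    show "(\<lambda>A. g A z) \<in> borel_measurable M" for z
      unfolding g_def using meas by (intro borel_measurable_sum borel_measurable_abs borel_measurable_times) auto
  qed (simp add: g_def sum_nonneg)
  also have "{A \<in> space M. \<exists>z\<in>K. g A z = 0} = {A \<in> space M. \<exists>z \<in> vecs n. z \<noteq> (\<lambda>_. 0) \<and> (\<forall>i<m. (\<Sum>j<n. A (i, j) * z j) = (0::real)) \<and>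
         (\<Sum>i\<in>{..<n} - T. \<bar>z i\<bar> powr p) \<le> (\<Sum>i\<in>T. \<bar>z i\<bar> powr p)}"
  proof (intro Collect_cong conj_cong refl iffI)
    fix A assume "\<exists>z\<in>K. g A z = 0"
    then obtain z where "z \<in> K" "g A z = 0" by blast
    moreover have "z \<noteq> (\<lambda>_. 0)" using \<open>z \<in> K\<close> by (auto simp: K_def)
    ultimately show "\<exists>z \<in> vecs n. z \<noteq> (\<lambda>_. 0) \<and> (\<forall>i<m. (\<Sum>j<n. A (i, j) * z j) = (0::real)) \<and>
         (\<Sum>i\<in>{..<n} - T. \<bar>z i\<bar> powr p) \<le> (\<Sum>i\<in>T. \<bar>z i\<bar> powr p)"
      by (intro bexI[of _ z]) (auto simp: g0 K_def)
  next
    fix A assume "\<exists>z \<in> vecs n. z \<noteq> (\<lambda>_. 0) \<and> (\<forall>i<m. (\<Sum>j<n. A (i, j) * z j) = (0::real)) \<and>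
         (\<Sum>i\<in>{..<n} - T. \<bar>z i\<bar> powr p) \<le> (\<Sum>i\<in>T. \<bar>z i\<bar> powr p)"
    then obtain z where z: "z \<in> vecs n" "z \<noteq> (\<lambda>_. 0)" "\<forall>i<m. (\<Sum>j<n. A (i, j) * z j) = 0"
      "(\<Sum>i\<in>{..<n} - T. \<bar>z i\<bar> powr p) \<le> (\<Sum>i\<in>T. \<bar>z i\<bar> powr p)" by blast
    define S where "S = (\<Sum>i<n. \<bar>z i\<bar>)"
    have S: "S > 0"
    proof -
      obtain i where i: "z i \<noteq> 0" using z(2) by auto
      have "\<not> n \<le> i" using z(1) i by (auto simp: vecs_def)
      then have "i < n" by simp
      with i show ?thesis unfolding S_def by (intro sum_pos2[where i = i]) simp_all
    qed
    define y where "y = (\<lambda>i. z i / S)"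
    have y1: "y \<in> vecs n" using z(1) by (simp add: vecs_def y_def)
    have "(\<Sum>i<n. \<bar>y i\<bar>) = (\<Sum>i<n. \<bar>z i\<bar>) / S"
      unfolding sum_divide_distrib y_def using S by simp
    then have y2: "(\<Sum>i<n. \<bar>y i\<bar>) = 1" using S by (simp add: S_def)
    have "(\<Sum>i\<in>I. \<bar>y i\<bar> powr p) = (\<Sum>i\<in>I. \<bar>z i\<bar> powr p) / S powr p" for I
      unfolding sum_divide_distrib y_def using S by (simp add: powr_divide)
    then have y3: "(\<Sum>i\<in>{..<n} - T. \<bar>y i\<bar> powr p) \<le> (\<Sum>i\<in>T. \<bar>y i\<bar> powr p)"
      using z(4) by (simp add: divide_right_mono)
    have "(\<Sum>j<n. A (i, j) * y j) = (\<Sum>j<n. A (i, j) * z j) / S" for i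
      unfolding sum_divide_distrib y_def by simp
    then have "g A y = 0"
      unfolding g0 using z(3) by simp
    with y1 y2 y3 show "\<exists>z\<in>K. g A z = 0" by (intro bexI[of _ y]) (simp_all add: K_def)
  qed
  finally show ?thesis .
qed

text \<open>For U of maximal p-mass, a threshold \<tau> separates the moduli on U from those off U.
  Writing |z| as its p-th power times its (1 - p)-th power, the second factor is at most that of
  \<tau> off U and at least that of \<tau> on U, so the p-inequality carries over to l1.\<close>

lemma lp_failure_imp_l1_failure:
  fixes z :: "'a \<Rightarrow> real"
  assumes I: "finite I" and T: "T \<subseteq> I" and p: "0 < p" "p \<le> 1"
    and fail: "(\<Sum>i\<in>I - T. \<bar>z i\<bar> powr p) \<le> (\<Sum>i\<in>T. \<bar>z i\<bar> powr p)"
  obtains U where "U \<subseteq> I" "card U \<le> card T" "(\<Sum>i\<in>I - U. \<bar>z i\<bar>) \<le> (\<Sum>i\<in>U. \<bar>z i\<bar>)"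
proof -
  define f where "f = (\<lambda>U. \<Sum>i\<in>U. \<bar>z i\<bar> powr p)"
  define \<U> where "\<U> = {U. U \<subseteq> I \<and> card U \<le> card T}"
  have \<U>: "finite \<U>" "T \<in> \<U>" using I T by (auto simp: \<U>_def)
  then have "Max (f ` \<U>) \<in> f ` \<U>" by (intro Max_in) auto
  then obtain U where U: "U \<in> \<U>" "Max (f ` \<U>) = f U" by auto
  have max: "f V \<le> f U" if "V \<in> \<U>" for V
    using that \<U> by (simp flip: U(2))
  have UI: "U \<subseteq> I" "card U \<le> card T" using U by (auto simp: \<U>_def)
  have fin: "finite U" using UI I finite_subset by blast
  \<comment> \<open>Otherwise swapping i for j would keep the cardinality and raise the
    p-mass.\<close>
  have exchange: "\<bar>z j\<bar> \<le> \<bar>z i\<bar>" if i: "i \<in> U" and j: "j \<in> I - U" for i j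
  proof (rule ccontr)
    assume "\<not> \<bar>z j\<bar> \<le> \<bar>z i\<bar>"
    then have lt: "\<bar>z i\<bar> powr p < \<bar>z j\<bar> powr p" using p by (intro powr_less_mono2) auto
    have "card (insert j (U - {i})) = card U" using i j fin card_Suc_Diff1[OF fin i] by simp
    then have "insert j (U - {i}) \<in> \<U>" using i j UI by (auto simp: \<U>_def)
    from max[OF this] have "f (insert j (U - {i})) \<le> f U" .
    moreover have "f (insert j (U - {i})) = \<bar>z j\<bar> powr p + f (U - {i})" using j fin by (simp add: f_def)
    moreover have "f U = \<bar>z i\<bar> powr p + f (U - {i})" unfolding f_def by (rule sum.remove[OF fin i])
    ultimately show False using lt by linarith
  qed
  \<comment> \<open>The total mass is fixed, so passing from T to U can only worsen the
    failure.\<close>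
  have "f U + f (I - U) = f T + f (I - T)"
    unfolding f_def using sum.subset_diff[OF UI(1) I, of "\<lambda>i. \<bar>z i\<bar> powr p"] sum.subset_diff[OF T I, of "\<lambda>i. \<bar>z i\<bar> powr p"] by simp
  with max[OF \<U>(2)] fail have le: "f (I - U) \<le> f U" by (simp add: f_def)
  \<comment> \<open>This includes x = 0, where \<open>powr\<close> has the value 0 for every
    exponent.\<close>
  have split: "x = x powr p * x powr (1 - p)" if "0 \<le> x" for x :: real
    using that by (simp flip: powr_add)
  have "(\<Sum>i\<in>I - U. \<bar>z i\<bar>) \<le> (\<Sum>i\<in>U. \<bar>z i\<bar>)"
  proof (cases "I - U = {}")
    case True
    then show ?thesis by (simp only: sum.empty) (simp add: sum_nonneg)
  next
    case False
    define \<tau> where "\<tau> = Max ((\<lambda>i. \<bar>z i\<bar>) ` (I - U))"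
    have fin': "finite ((\<lambda>i. \<bar>z i\<bar>) ` (I - U))" using I by simp
    have \<tau>: "\<bar>z j\<bar> \<le> \<tau>" if "j \<in> I - U" for j
      unfolding \<tau>_def using fin' that by (intro Max_ge) auto
    have "\<tau> \<in> (\<lambda>i. \<bar>z i\<bar>) ` (I - U)" unfolding \<tau>_def using fin' False by (intro Max_in) auto
    then obtain j where j: "j \<in> I - U" "\<tau> = \<bar>z j\<bar>" by auto
    have "(\<Sum>i\<in>I - U. \<bar>z i\<bar>) \<le> (\<Sum>i\<in>I - U. \<bar>z i\<bar> powr p * \<tau> powr (1 - p))"
    proof (intro sum_mono)
      fix i assume "i \<in> I - U"
      then have "\<bar>z i\<bar> powr p * \<bar>z i\<bar> powr (1 - p) \<le> \<bar>z i\<bar> powr p * \<tau> powr (1 - p)"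
        using p \<tau> by (intro mult_left_mono powr_mono2) auto
      then show "\<bar>z i\<bar> \<le> \<bar>z i\<bar> powr p * \<tau> powr (1 - p)" using split[of "\<bar>z i\<bar>"] by simp
    qed
    also have "\<dots> = f (I - U) * \<tau> powr (1 - p)" by (simp add: f_def sum_distrib_right)
    also have "\<dots> \<le> f U * \<tau> powr (1 - p)" using le by (intro mult_right_mono) auto
    also have "\<dots> = (\<Sum>i\<in>U. \<bar>z i\<bar> powr p * \<tau> powr (1 - p))" by (simp add: f_def sum_distrib_right)
    also have "\<dots> \<le> (\<Sum>i\<in>U. \<bar>z i\<bar>)"
    proof (intro sum_mono)
      fix i assume "i \<in> U"
      then have "\<tau> \<le> \<bar>z i\<bar>" using exchange j by auto
      then have "\<bar>z i\<bar> powr p * \<tau> powr (1 - p) \<le> \<bar>z i\<bar> powr p * \<bar>z i\<bar> powr (1 - p)"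
        using p j by (intro mult_left_mono powr_mono2) auto
      then show "\<bar>z i\<bar> powr p * \<tau> powr (1 - p) \<le> \<bar>z i\<bar>" using split[of "\<bar>z i\<bar>"] by simp
    qed
    finally show ?thesis .
  qed
  with UI show thesis using that by blast
qed

section \<open>The deterministic argument: peeling into sign vectors, and rounding\<close>

text \<open>Cauchy--Schwarz in the plane: after squaring, the cross term is bounded by the
  inequality of arithmetic and geometric means for ad and cb.\<close>

lemma sqrt_mult_add_le:
  fixes a b c d :: real
  assumes "0 \<le> a" "0 \<le> b" "0 \<le> c" "0 \<le> d"
  shows "sqrt (a * b) + sqrt (c * d) \<le> sqrt ((a + c) * (b + d))"
proof (rule real_le_rsqrt)
  have "2 * sqrt ((a * d) * (c * b)) \<le> a * d + c * b"
    using assms arith_geo_mean_sqrt[of "a * d" "c * b"] by simp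
  moreover have "sqrt (a * b) * sqrt (c * d) = sqrt ((a * d) * (c * b))"
    by (simp flip: real_sqrt_mult add: ac_simps)
  ultimately show "(sqrt (a * b) + sqrt (c * d))\<^sup>2 \<le> (a + c) * (b + d)"
    using assms by (simp add: power2_sum algebra_simps)
qed

text \<open>Induction on the support: subtract the multiple \<open>\<tau> w\<close> of the sign vector of \<open>e\<close>, where \<open>\<tau>\<close> is
  the smallest nonzero modulus. The bound is a square root of a product so that Cauchy--Schwarz
  closes the step.\<close>

lemma seminorm_le_of_sign_vectors:
  fixes F :: "('a \<Rightarrow> real) \<Rightarrow> real"
  assumes I: "finite I" and C: "0 \<le> C"
    and sub: "\<And>x y. F (\<lambda>i. x i + y i) \<le> F x + F y"
    and hom: "\<And>c x. 0 \<le> c \<Longrightarrow> F (\<lambda>i. c * x i) = c * F x"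
    and sign: "\<And>w. (\<And>i. w i \<in> {-1, 0, 1}) \<Longrightarrow> F w \<le> C * sqrt (\<Sum>i\<in>I. (w i)\<^sup>2)"
    and e: "\<And>i. i \<notin> I \<Longrightarrow> e i = 0" "\<And>i. \<bar>e i\<bar> \<le> M"
  shows "F e \<le> C * sqrt (M * (\<Sum>i\<in>I. \<bar>e i\<bar>))"
  using e
proof (induction "card {i\<in>I. e i \<noteq> 0}" arbitrary: e M rule: less_induct)
  case less
  define S where "S = {i\<in>I. e i \<noteq> 0}"
  have S: "finite S" "S \<subseteq> I" using I by (auto simp: S_def)
  have e0: "e i = 0" if "i \<notin> S" for i using that less.prems(1)[of i] by (auto simp: S_def)
  show ?case
  proof (cases "S = {}")
    case True
    then have "e = (\<lambda>_. 0)" using e0 by auto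
    then show ?thesis using sign[of e] by simp
  next
    case False
    define \<tau> where "\<tau> = Min ((\<lambda>i. \<bar>e i\<bar>) ` S)"
    have \<tau>_le: "\<tau> \<le> \<bar>e i\<bar>" if "i \<in> S" for i unfolding \<tau>_def using S that by (intro Min_le) auto
    have "\<tau> \<in> (\<lambda>i. \<bar>e i\<bar>) ` S" unfolding \<tau>_def using S False by (intro Min_in) auto
    then obtain k where k: "k \<in> S" "\<tau> = \<bar>e k\<bar>" by auto
    then have \<tau>: "0 < \<tau>" by (auto simp: S_def)
    define w where "w = (\<lambda>i. sgn (e i))"
    define e' where "e' = (\<lambda>i. e i - \<tau> * w i)"
    \<comment> \<open>Each modulus on the support drops by exactly \<tau>, hence the sup bound by
      \<tau> and the l1 norm by \<tau> \<open>card S\<close>.\<close>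
    have abs_e': "\<bar>e' i\<bar> = \<bar>e i\<bar> - (if i \<in> S then \<tau> else 0)" for i
    proof (cases "i \<in> S")
      case True
      then show ?thesis using \<tau>_le[OF True] \<tau> by (auto simp: e'_def w_def sgn_if S_def)
    qed (simp add: e'_def w_def e0)
    have M: "\<tau> \<le> M" using less.prems(2)[of k] k by simp
    have "card {i\<in>I. e' i \<noteq> 0} < card {i\<in>I. e i \<noteq> 0}"
    proof (intro psubset_card_mono psubsetI)
      show "{i\<in>I. e' i \<noteq> 0} \<subseteq> {i\<in>I. e i \<noteq> 0}" by (auto simp: e'_def w_def)
      \<comment> \<open>The index attaining the minimum leaves the support, so the induction measure
        decreases.\<close>
      have "e' k = 0" using abs_e'[of k] k by simp
      then show "{i\<in>I. e' i \<noteq> 0} \<noteq> {i\<in>I. e i \<noteq> 0}" using k by (auto simp: S_def)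
    qed (simp add: I)
    moreover have "e' i = 0" if "i \<notin> I" for i using less.prems(1)[OF that] by (simp add: e'_def w_def)
    moreover have "\<bar>e' i\<bar> \<le> M - \<tau>" for i
      using less.prems(2)[of i] abs_e'[of i] M e0[of i] by (auto split: if_splits)
    ultimately have IH: "F e' \<le> C * sqrt ((M - \<tau>) * (\<Sum>i\<in>I. \<bar>e' i\<bar>))"
      by (intro less.hyps)
    have sum_e': "(\<Sum>i\<in>I. \<bar>e' i\<bar>) = (\<Sum>i\<in>I. \<bar>e i\<bar>) - \<tau> * card S"
      using S I by (simp add: abs_e' sum_subtractf sum.If_cases Int_absorb1 ac_simps)
    have sum_w: "(\<Sum>i\<in>I. (w i)\<^sup>2) = card S"
    proof -
      have "(\<Sum>i\<in>I. (w i)\<^sup>2) = (\<Sum>i\<in>S. 1)"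
        using S I by (intro sum.mono_neutral_cong_right) (auto simp: w_def S_def sgn_if)
      then show ?thesis by simp
    qed
    have "e = (\<lambda>i. \<tau> * w i + e' i)" by (simp add: e'_def)
    then have "F e \<le> F (\<lambda>i. \<tau> * w i) + F e'" using sub[of "\<lambda>i. \<tau> * w i" e'] by simp
    also have "\<dots> \<le> \<tau> * (C * sqrt (card S)) + C * sqrt ((M - \<tau>) * ((\<Sum>i\<in>I. \<bar>e i\<bar>) - \<tau> * card S))"
    proof (intro add_mono)
      have "F w \<le> C * sqrt (card S)"
        unfolding sum_w[symmetric] by (rule sign) (simp add: w_def sgn_if)
      then show "F (\<lambda>i. \<tau> * w i) \<le> \<tau> * (C * sqrt (card S))"
        using \<tau> by (simp add: hom)
    qed (use IH sum_e' in simp)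
    \<comment> \<open>Both terms become square roots of products; under Cauchy--Schwarz the first
      factors add up to \<open>M\<close> and the second ones to the l1 norm of
      \<open>e\<close>.\<close>
    also have "\<dots> = C * (sqrt (\<tau> * (\<tau> * card S)) + sqrt ((M - \<tau>) * ((\<Sum>i\<in>I. \<bar>e i\<bar>) - \<tau> * card S)))"
      using \<tau> by (simp add: algebra_simps real_sqrt_mult)
    also have "\<dots> \<le> C * sqrt ((\<tau> + (M - \<tau>)) * (\<tau> * card S + ((\<Sum>i\<in>I. \<bar>e i\<bar>) - \<tau> * card S)))"
    proof (intro mult_left_mono sqrt_mult_add_le C)
      show "0 \<le> (\<Sum>i\<in>I. \<bar>e i\<bar>) - \<tau> * card S" unfolding sum_e'[symmetric] by (intro sum_nonneg) simp
    qed (use \<tau> M in auto)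
    finally show ?thesis by simp
  qed
qed

text \<open>With y the multiple of z of l1 norm \<open>N\<close>, A y = 0 gives the rounded vector
  \<open>v\<close> and the error \<open>e\<close> the same image. The squared norm of that image is
  at most \<open>a * N\<close> seen from \<open>e\<close> and at least
  \<open>b * N * (L / 8 - 1)\<close> seen from \<open>v\<close>; the condition on \<open>L\<close>
  makes these incompatible.\<close>

lemma l1_null_space_property:
  assumes up: "\<And>w. (\<And>j. w j \<in> {-1, 0, 1}) \<Longrightarrow> quad m n A w \<le> a * (\<Sum>j<n. (w j)\<^sup>2)"
    and low: "\<And>v. (\<And>j. v j \<in> \<int>) \<Longrightarrow> (\<Sum>j<n. \<bar>v j\<bar>) \<le> N \<Longrightarrow> b * (\<Sum>j<n. (v j)\<^sup>2) \<le> quad m n A v"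
    and N: "0 < N" and a: "0 \<le> a" and b: "0 < b" and L: "0 < L" "a < b * (L / 8 - 1)"
    and T: "T \<subseteq> {..<n}" "real (card T) * L \<le> N"
    and z: "z \<in> vecs n" "\<And>i. i < m \<Longrightarrow> (\<Sum>j<n. A (i, j) * z j) = 0"
    and fail: "(\<Sum>j\<in>{..<n} - T. \<bar>z j\<bar>) \<le> (\<Sum>j\<in>T. \<bar>z j\<bar>)"
  shows "z = (\<lambda>_. 0)"
proof (rule ccontr)
  assume "z \<noteq> (\<lambda>_. 0)"
  then obtain k where k: "z k \<noteq> 0" by auto
  have "\<not> n \<le> k" using z(1) k by (auto simp: vecs_def)
  then have kn: "k < n" by simp
  define S where "S = (\<Sum>j<n. \<bar>z j\<bar>)"
  have S: "0 < S" unfolding S_def using k kn by (intro sum_pos2[where i = k]) auto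
  define y where "y = (\<lambda>j. N / S * z j)"
  \<comment> \<open>Rounding towards zero never increases a modulus, which keeps the l1 norms of
    both \<open>v\<close> and \<open>e\<close> below \<open>N\<close>, and the error stays at most
    1.\<close>
  define v where "v = (\<lambda>j. sgn (y j) * of_int \<lfloor>\<bar>y j\<bar>\<rfloor>)"
  define e where "e = (\<lambda>j. v j - y j)"
  define F where "F = (\<lambda>x. sqrt (quad m n A x))"
  have v: "v j \<in> \<int>" "\<bar>v j\<bar> \<le> \<bar>y j\<bar>" "\<bar>e j\<bar> \<le> \<bar>y j\<bar>" "\<bar>e j\<bar> \<le> 1" for j
  proof -
    show "v j \<in> \<int>" by (auto simp: v_def sgn_if)
    define f where "f = real_of_int \<lfloor>\<bar>y j\<bar>\<rfloor>"
    have f: "f \<le> \<bar>y j\<bar>" "0 \<le> f" "\<bar>y j\<bar> < f + 1"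
      unfolding f_def by (simp, simp, linarith)
    have "v j = sgn (y j) * f" by (simp add: v_def f_def)
    then have "v j = (if y j < 0 then - f else f)"
      using f by (auto simp: sgn_if)
    with f show "\<bar>v j\<bar> \<le> \<bar>y j\<bar>" "\<bar>e j\<bar> \<le> \<bar>y j\<bar>" "\<bar>e j\<bar> \<le> 1"
      unfolding e_def by (auto split: if_splits)
  qed
  have y_sum: "(\<Sum>j\<in>J. \<bar>y j\<bar>) = N / S * (\<Sum>j\<in>J. \<bar>z j\<bar>)" for J
    unfolding y_def sum_distrib_left using N S by (simp add: abs_mult)
  have y1: "(\<Sum>j<n. \<bar>y j\<bar>) = N" using S by (simp add: y_sum S_def[symmetric])
  have e1: "(\<Sum>j<n. \<bar>e j\<bar>) \<le> N" unfolding y1[symmetric] by (intro sum_mono v)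
  have v1: "(\<Sum>j<n. \<bar>v j\<bar>) \<le> N" unfolding y1[symmetric] by (intro sum_mono v)
  have "(\<Sum>j<n. (e j)\<^sup>2) \<le> (\<Sum>j<n. \<bar>e j\<bar>)"
  proof (intro sum_mono)
    fix j
    have "\<bar>e j\<bar> * \<bar>e j\<bar> \<le> \<bar>e j\<bar> * 1" using v by (intro mult_left_mono) auto
    then show "(e j)\<^sup>2 \<le> \<bar>e j\<bar>" by (simp add: power2_eq_square)
  qed
  with e1 have e2: "(\<Sum>j<n. (e j)\<^sup>2) \<le> N" by linarith
  have "(\<Sum>j\<in>{..<n} - T. \<bar>y j\<bar>) \<le> (\<Sum>j\<in>T. \<bar>y j\<bar>)"
    unfolding y_sum using fail N S by (intro mult_left_mono) auto
  moreover have "N = (\<Sum>j\<in>{..<n} - T. \<bar>y j\<bar>) + (\<Sum>j\<in>T. \<bar>y j\<bar>)"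
    unfolding y1[symmetric] by (intro sum.subset_diff T) simp
  ultimately have "N / 2 \<le> (\<Sum>j\<in>T. \<bar>y j\<bar>)" by linarith
  \<comment> \<open>Cauchy--Schwarz on T, whose cardinality is at most \<open>N / L\<close>, turns
    half of the l1 mass into a large l2 norm.\<close>
  then have "(N / 2)\<^sup>2 \<le> (\<Sum>j\<in>T. \<bar>y j\<bar>)\<^sup>2" using N by (intro power_mono) auto
  also have "\<dots> \<le> real (card T) * (\<Sum>j\<in>T. (y j)\<^sup>2)"
    using sum_squared_le_sum_of_squares[of "\<lambda>j. \<bar>y j\<bar>" T] by (simp add: mult.commute)
  also have "\<dots> \<le> N / L * (\<Sum>j<n. (y j)\<^sup>2)"
    using T L N by (intro mult_mono sum_mono2) (auto simp: field_simps sum_nonneg)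
  finally have y2: "N * L / 4 \<le> (\<Sum>j<n. (y j)\<^sup>2)"
    using N L by (simp add: field_simps power2_eq_square)
  \<comment> \<open>The factor 2 lost here turns the \<open>L / 4\<close> of the bound for y into
    \<open>L / 8\<close>, and the error accounts for the \<open>- 1\<close>.\<close>
  have "(\<Sum>j<n. (y j)\<^sup>2) \<le> (\<Sum>j<n. 2 * (v j)\<^sup>2 + 2 * (e j)\<^sup>2)"
  proof (intro sum_mono)
    fix j
    have "(y j)\<^sup>2 = (v j - e j)\<^sup>2" by (simp add: e_def)
    also have "\<dots> \<le> (v j - e j)\<^sup>2 + (v j + e j)\<^sup>2" by simp
    also have "\<dots> = 2 * (v j)\<^sup>2 + 2 * (e j)\<^sup>2" by (simp add: power2_eq_square algebra_simps)
    finally show "(y j)\<^sup>2 \<le> 2 * (v j)\<^sup>2 + 2 * (e j)\<^sup>2" .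
  qed
  also have "\<dots> = 2 * (\<Sum>j<n. (v j)\<^sup>2) + 2 * (\<Sum>j<n. (e j)\<^sup>2)"
    by (simp add: sum.distrib sum_distrib_left)
  finally have v2: "N * (L / 8 - 1) \<le> (\<Sum>j<n. (v j)\<^sup>2)"
    using y2 e2 by (simp add: algebra_simps)
  have F: "F x = L2_set (\<lambda>i. \<Sum>j<n. A (i, j) * x j) {..<m}" for x
    by (simp add: F_def quad_def L2_set_def)
  \<comment> \<open>The peeling bound applies with sup bound 1.\<close>
  have "F e \<le> sqrt a * sqrt (1 * (\<Sum>j<n. \<bar>e j\<bar>))"
  proof (rule seminorm_le_of_sign_vectors)
    show "F (\<lambda>i. x i + x' i) \<le> F x + F x'" for x x'
      unfolding F distrib_left sum.distrib by (rule L2_set_triangle_ineq)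
    show "F (\<lambda>i. c * x i) = c * F x" if "0 \<le> c" for c x
      unfolding F using that
      by (simp add: L2_set_right_distrib sum_distrib_left mult.left_commute)
    show "F w \<le> sqrt a * sqrt (\<Sum>j<n. (w j)\<^sup>2)" if "\<And>j. w j \<in> {-1, 0, 1}" for w
      unfolding F_def real_sqrt_mult[symmetric] using up[OF that] by simp
    show "e j = 0" if "j \<notin> {..<n}" for j
      using z(1) that by (simp add: e_def v_def y_def vecs_def)
  qed (use a v in auto)
  also have "\<dots> \<le> sqrt (a * N)" using e1 a by (simp add: real_sqrt_mult[symmetric] mult_left_mono)
  also have "F e = F v"
  proof -
    have "(\<Sum>j<n. A (i, j) * y j) = 0" if "i < m" for i
    proof -
      have "(\<Sum>j<n. A (i, j) * y j) = N / S * (\<Sum>j<n. A (i, j) * z j)"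
        unfolding y_def sum_distrib_left by (simp add: mult.left_commute)
      with z(2)[OF that] show ?thesis by simp
    qed
    then show ?thesis
      unfolding F e_def right_diff_distrib sum_subtractf by (intro L2_set_cong) auto
  qed
  finally have "quad m n A v \<le> a * N" by (simp add: F_def)
  moreover have "b * (N * (L / 8 - 1)) \<le> b * (\<Sum>j<n. (v j)\<^sup>2)" using v2 b by (intro mult_left_mono) auto
  moreover have "b * (\<Sum>j<n. (v j)\<^sup>2) \<le> quad m n A v" by (intro low v v1)
  moreover have "a * N < b * (L / 8 - 1) * N" using L N by (intro mult_strict_right_mono) auto
  ultimately show False by (simp add: algebra_simps)
qed

section \<open>Counting integer points in an l1 ball\<close>

lemma sum_power_abs_le:
  fixes q :: real
  assumes q: "0 \<le> q" "q \<le> 1 / 2"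
  shows "(\<Sum>k\<in>{- int b..int b}. q ^ nat \<bar>k\<bar>) \<le> 1 + 4 * q"
proof -
  \<comment> \<open>The claim is strengthened by a slack that pays for the tail: a new pair costs
    \<open>2 * q ^ Suc b\<close>, and for q at most 1/2 the slack shrinks by at least as
    much.\<close>
  have "(\<Sum>k\<in>{- int b..int b}. q ^ nat \<bar>k\<bar>) + 4 * q ^ Suc b \<le> 1 + 4 * q"
  proof (induction b)
    case (Suc b)
    have "{- int (Suc b)..int (Suc b)} = insert (- int (Suc b)) (insert (int (Suc b)) {- int b..int b})"
      by auto
    then have "(\<Sum>k\<in>{- int (Suc b)..int (Suc b)}. q ^ nat \<bar>k\<bar>) = (\<Sum>k\<in>{- int b..int b}. q ^ nat \<bar>k\<bar>) + 2 * q ^ Suc b"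
      by (simp add: nat_add_distrib)
    moreover have "4 * q ^ Suc (Suc b) \<le> 2 * q ^ Suc b"
      using mult_right_mono[OF q(2), of "q ^ Suc b"] q(1) by simp
    ultimately show ?case using Suc.IH by linarith
  qed simp
  then show ?thesis using q by (smt (verit) zero_le_power)
qed

text \<open>Give a point the weight q to the power of its l1 norm. Points of the ball weigh at least
  \<open>q powr N\<close>, while the weight of the whole box factors over the coordinates into
  geometric sums, bounded independently of \<open>b\<close>.\<close>

lemma card_int_l1_ball_le:
  fixes q N :: real
  assumes q: "0 < q" "q \<le> 1 / 2"
  shows "real (card {v \<in> {..<n} \<rightarrow>\<^sub>E {- int b..int b}. (\<Sum>j<n. \<bar>real_of_int (v j)\<bar>) \<le> N})
    \<le> q powr (- N) * exp (4 * q * real n)"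
proof -
  let ?P = "{..<n} \<rightarrow>\<^sub>E {- int b..int b}"
  let ?V = "{v \<in> ?P. (\<Sum>j<n. \<bar>real_of_int (v j)\<bar>) \<le> N}"
  have fin: "finite ?P" by (intro finite_PiE) auto
  have "real (card ?V) * q powr N = (\<Sum>v\<in>?V. q powr N)" by simp
  also have "\<dots> \<le> (\<Sum>v\<in>?V. \<Prod>j<n. q ^ nat \<bar>v j\<bar>)"
  proof (intro sum_mono)
    fix v assume v: "v \<in> ?V"
    have "q powr N \<le> q powr (\<Sum>j<n. \<bar>real_of_int (v j)\<bar>)"
      using v q by (intro powr_mono') auto
    also have "\<dots> = (\<Prod>j<n. q powr \<bar>real_of_int (v j)\<bar>)" using q by (simp add: powr_sum)
    also have "\<dots> = (\<Prod>j<n. q ^ nat \<bar>v j\<bar>)"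
      using q by (intro prod.cong refl) (simp flip: powr_realpow)
    finally show "q powr N \<le> (\<Prod>j<n. q ^ nat \<bar>v j\<bar>)" .
  qed
  also have "\<dots> \<le> (\<Sum>v\<in>?P. \<Prod>j<n. q ^ nat \<bar>v j\<bar>)"
  proof (rule sum_mono2[OF fin])
    show "0 \<le> (\<Prod>j<n. q ^ nat \<bar>v j\<bar>)" for v :: "nat \<Rightarrow> int"
      using q by (intro prod_nonneg) simp
  qed blast
  also have "\<dots> = (\<Prod>j<n. \<Sum>k\<in>{- int b..int b}. q ^ nat \<bar>k\<bar>)"
    by (rule prod_sum_PiE[symmetric]) auto
  also have "\<dots> \<le> (\<Prod>j<n. 1 + 4 * q)"
    using sum_power_abs_le[of q b] q by (intro prod_mono conjI sum_nonneg) auto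
  also have "\<dots> \<le> (\<Prod>j<n. exp (4 * q))"
    using q by (intro prod_mono conjI) auto
  also have "\<dots> = exp (4 * q * real n)" by (simp add: exp_of_nat_mult[symmetric] mult.commute)
  finally show ?thesis using q by (simp add: powr_minus field_simps)
qed

section \<open>Measurability of the recovery event\<close>

text \<open>By the null space property, failure is a finite union over T of measurable events.
  Measurability is what later permits bounding the probability from below by monotonicity.\<close>

lemma measurable_sparse_recovery:
  assumes p: "0 < p" "p \<le> 1"
  shows "{A \<in> space (gaussian_matrix m n). sparse_recovery p s m n A} \<in> sets (gaussian_matrix m n)"
proof -
  let ?M = "gaussian_matrix m n"
  define B where "B = (\<lambda>T. {A \<in> space ?M. \<exists>z \<in> vecs n. z \<noteq> (\<lambda>_. 0) \<and> (\<forall>i<m. (\<Sum>j<n. A (i, j) * z j) = 0) \<and>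
         (\<Sum>i\<in>{..<n} - T. \<bar>z i\<bar> powr p) \<le> (\<Sum>i\<in>T. \<bar>z i\<bar> powr p)})"
  define \<T> where "\<T> = {T. T \<subseteq> {..<n} \<and> real (card T) \<le> s}"
  have fin: "finite \<T>" unfolding \<T>_def by (rule finite_subset[of _ "Pow {..<n}"]) auto
  have "B T \<in> sets ?M" if "T \<in> \<T>" for T
    unfolding B_def using that p by (intro measurable_null_space_failure) (auto simp: \<T>_def)
  then have "space ?M - (\<Union>T\<in>\<T>. B T) \<in> sets ?M"
    using fin by (intro sets.compl_sets sets.finite_UN) auto
  also have "space ?M - (\<Union>T\<in>\<T>. B T) = {A \<in> space ?M. sparse_recovery p s m n A}"
  proof (intro set_eqI iffI)
    fix A assume A: "A \<in> space ?M - (\<Union>T\<in>\<T>. B T)"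
    have "sparse_recovery p s m n A"
      unfolding sparse_recovery_iff_null_space_property[OF p]
    proof (intro allI impI ballI)
      fix T z assume T: "T \<subseteq> {..<n}" "real (card T) \<le> s" and z: "z \<in> vecs n" "z \<noteq> (\<lambda>_. 0)"
        "\<forall>i<m. (\<Sum>j<n. A (i, j) * z j) = 0"
      show "(\<Sum>i\<in>T. \<bar>z i\<bar> powr p) < (\<Sum>i\<in>{..<n} - T. \<bar>z i\<bar> powr p)"
      proof (rule ccontr)
        assume "\<not> ?thesis"
        then have "A \<in> B T"
          unfolding B_def using A z by (intro CollectI conjI bexI[of _ z]) auto
        with A T show False by (auto simp: \<T>_def)
      qed
    qed
    with A show "A \<in> {A \<in> space ?M. sparse_recovery p s m n A}" by simp
  next
    fix A assume "A \<in> {A \<in> space ?M. sparse_recovery p s m n A}"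
    then have A: "A \<in> space ?M" and rec: "sparse_recovery p s m n A" by auto
    have "A \<notin> B T" if "T \<in> \<T>" for T
    proof
      assume "A \<in> B T"
      then obtain z where z: "z \<in> vecs n" "z \<noteq> (\<lambda>_. 0)" "\<forall>i<m. (\<Sum>j<n. A (i, j) * z j) = 0"
        "(\<Sum>i\<in>{..<n} - T. \<bar>z i\<bar> powr p) \<le> (\<Sum>i\<in>T. \<bar>z i\<bar> powr p)" by (auto simp: B_def)
      have "(\<Sum>i\<in>T. \<bar>z i\<bar> powr p) < (\<Sum>i\<in>{..<n} - T. \<bar>z i\<bar> powr p)"
        using rec[unfolded sparse_recovery_iff_null_space_property[OF p]] that z by (simp add: \<T>_def)
      with z(4) show False by simp
    qed
    with A show "A \<in> space ?M - (\<Union>T\<in>\<T>. B T)" by auto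
  qed
  finally show ?thesis .
qed

section \<open>Failure probabilities of the two families of bounds\<close>

lemma quad_cong: "(\<And>j. j < n \<Longrightarrow> v j = w j) \<Longrightarrow> quad m n A v = quad m n A w"
  unfolding quad_def by (intro sum.cong arg_cong[where f = "\<lambda>x. x\<^sup>2"]) auto

text \<open>The inequality is strict so that a vector vanishing below \<open>n\<close> contributes
  the empty event; the tail bound covers only nonzero vectors.\<close>

lemma prob_quad_union_bound:
  assumes V: "finite V" and \<sigma>: "0 < \<sigma>" and a: "a = (1 - 1 / \<sigma>\<^sup>2) / 2"
  shows "measure (gaussian_matrix m n) {A \<in> space (gaussian_matrix m n). \<exists>v\<in>V. a * t * (\<Sum>j<n. (v j)\<^sup>2) < a * quad m n A v}
    \<le> real (card V) * (exp (- a * t) * \<sigma> ^ m)"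
proof -
  interpret prob_space "gaussian_matrix m n" by (rule prob_space_gaussian_matrix)
  let ?M = "gaussian_matrix m n"
  let ?B = "\<lambda>v. {A \<in> space ?M. a * t * (\<Sum>j<n. (v j)\<^sup>2) < a * quad m n A v}"
  have "{A \<in> space ?M. \<exists>v\<in>V. a * t * (\<Sum>j<n. (v j)\<^sup>2) < a * quad m n A v} = (\<Union>v\<in>V. ?B v)" by auto
  also have "prob \<dots> \<le> (\<Sum>v\<in>V. prob (?B v))"
    using V by (intro finite_measure_subadditive_finite) auto
  also have "\<dots> \<le> (\<Sum>v\<in>V. exp (- a * t) * \<sigma> ^ m)"
  proof (intro sum_mono)
    fix v
    show "prob (?B v) \<le> exp (- a * t) * \<sigma> ^ m"
    proof (cases "(\<Sum>j<n. (v j)\<^sup>2) = 0")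
      case True
      then have "v j = 0" if "j < n" for j using that by (subst (asm) sum_nonneg_eq_0_iff) auto
      then have "quad m n A v = 0" for A by (simp add: quad_def)
      then have "?B v = {}" using True by simp
      then show ?thesis using \<sigma> by (simp only: measure_empty) simp
    next
      case False
      then have pos: "0 < (\<Sum>j<n. (v j)\<^sup>2)" using sum_nonneg[of "{..<n}" "\<lambda>j. (v j)\<^sup>2"] by simp
      have "prob (?B v) \<le> prob {A \<in> space ?M. a * t * (\<Sum>j<n. (v j)\<^sup>2) \<le> a * quad m n A v}"
        by (intro finite_measure_mono) auto
      also have "\<dots> \<le> exp (- a * t) * \<sigma> ^ m" by (rule prob_quad_chernoff[OF pos \<sigma> a])
      finally show ?thesis .
    qed
  qed
  finally show ?thesis by simp
qed

text \<open>With \<sigma> = 2 the exponent is 3/8. Each of the 3^n vectors fails with probability at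
  most exp(-3n) 2^m, and 6 is below exp 2.\<close>

lemma prob_sign_vectors_failure:
  assumes "m \<le> n"
  shows "measure (gaussian_matrix m n) {A \<in> space (gaussian_matrix m n).
      \<exists>w\<in>{..<n} \<rightarrow>\<^sub>E {-1, 0, 1}. 8 * real n * (\<Sum>j<n. (w j)\<^sup>2) < quad m n A w} \<le> exp (- real n)"
proof -
  let ?W = "{..<n} \<rightarrow>\<^sub>E {-1, 0, 1 :: real}"
  have "measure (gaussian_matrix m n) {A \<in> space (gaussian_matrix m n).
      \<exists>w\<in>?W. 3 / 8 * (8 * real n) * (\<Sum>j<n. (w j)\<^sup>2) < 3 / 8 * quad m n A w}
    \<le> real (card ?W) * (exp (- (3 / 8) * (8 * real n)) * 2 ^ m)"
    by (intro prob_quad_union_bound finite_PiE) (auto simp: power2_eq_square)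
  also have "real (card ?W) = 3 ^ n" by (simp add: card_PiE card_insert_if)
  also have "3 ^ n * (exp (- (3 / 8) * (8 * real n)) * 2 ^ m) \<le> 3 ^ n * (exp (- (3 / 8) * (8 * real n)) * 2 ^ n)"
    using assms by (intro mult_left_mono power_increasing) auto
  also have "\<dots> = 6 ^ n * exp (- 3 * real n)" by (simp flip: power_mult_distrib)
  also have "\<dots> \<le> exp 2 ^ n * exp (- 3 * real n)"
  proof (intro mult_right_mono power_mono)
    \<comment> \<open>The quadratic Taylor bound suffices, as 25/4 exceeds 6.\<close>
    have "(5 / 2 :: real) \<le> exp 1" using exp_lower_Taylor_quadratic[of "1::real"] by simp
    then have "(5 / 2 :: real)\<^sup>2 \<le> (exp 1)\<^sup>2" by (intro power_mono) auto
    then show "(6 :: real) \<le> exp 2" by (simp add: power2_eq_square flip: exp_add)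
  qed auto
  also have "\<dots> = exp (- real n)"
    by (simp flip: exp_of_nat_mult exp_add)
  finally show ?thesis by (simp add: mult.assoc)
qed

text \<open>With \<sigma> = 1/2 the exponent is -3/2, and its sign turns the union bound into one
  for the lower tail. The factor \<open>(1 / 2) ^ m\<close> has to beat the number of lattice
  points.\<close>

lemma prob_lattice_vectors_failure:
  assumes q: "0 < q" "q \<le> 1 / 2"
    and V: "V = (\<lambda>v j. real_of_int (v j)) ` {v \<in> {..<n} \<rightarrow>\<^sub>E {- int k..int k}. (\<Sum>j<n. \<bar>real_of_int (v j)\<bar>) \<le> N}"
  shows "measure (gaussian_matrix m n) {A \<in> space (gaussian_matrix m n).
      \<exists>v\<in>V. quad m n A v < t * (\<Sum>j<n. (v j)\<^sup>2)}
    \<le> q powr (- N) * exp (4 * q * real n) * (exp (3 / 2 * t) * (1 / 2) ^ m)"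
proof -
  let ?I = "{v \<in> {..<n} \<rightarrow>\<^sub>E {- int k..int k}. (\<Sum>j<n. \<bar>real_of_int (v j)\<bar>) \<le> N}"
  have fin: "finite ?I" by (rule finite_subset[of _ "{..<n} \<rightarrow>\<^sub>E {- int k..int k}"]) (auto intro: finite_PiE)
  then have finV: "finite V" unfolding V by (rule finite_imageI)
  have "measure (gaussian_matrix m n) {A \<in> space (gaussian_matrix m n).
      \<exists>v\<in>V. (- 3 / 2) * t * (\<Sum>j<n. (v j)\<^sup>2) < (- 3 / 2) * quad m n A v}
     \<le> real (card V) * (exp (- (- 3 / 2) * t) * (1 / 2) ^ m)"
    by (intro prob_quad_union_bound finV) (auto simp: power2_eq_square)
  also have "\<dots> \<le> q powr (- N) * exp (4 * q * real n) * (exp (- (- 3 / 2) * t) * (1 / 2) ^ m)"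
  proof (intro mult_right_mono)
    have "real (card V) \<le> real (card ?I)" unfolding V using card_image_le[OF fin] by simp
    also have "\<dots> \<le> q powr (- N) * exp (4 * q * real n)" by (rule card_int_l1_ball_le[OF q])
    finally show "real (card V) \<le> q powr (- N) * exp (4 * q * real n)" .
  qed auto
  finally show ?thesis by (simp add: mult.assoc)
qed

section \<open>From the two families of bounds to recovery\<close>

text \<open>The union bounds speak of finite sets of extensional functions, the rounding argument of
  arbitrary sign and integral vectors. Restriction below \<open>n\<close> bridges the two, and as
  \<open>k\<close> is at least \<open>N\<close> the box contains every integral vector of the l1
  ball.\<close>

lemma sparse_recovery_if_lattice_bounds:
  assumes p: "0 < p" "p \<le> 1"
    and up: "\<And>w. w \<in> {..<n} \<rightarrow>\<^sub>E {-1, 0, 1} \<Longrightarrow> quad m n A w \<le> a * (\<Sum>j<n. (w j)\<^sup>2)"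
    and low: "\<And>v. v \<in> {..<n} \<rightarrow>\<^sub>E {- int k..int k} \<Longrightarrow> (\<Sum>j<n. \<bar>real_of_int (v j)\<bar>) \<le> N \<Longrightarrow>
       b * (\<Sum>j<n. (real_of_int (v j))\<^sup>2) \<le> quad m n A (\<lambda>j. real_of_int (v j))"
    and N: "0 < N" "N \<le> real k" and a: "0 \<le> a" and b: "0 < b" and L: "0 < L" "a < b * (L / 8 - 1)"
    and s: "s * L \<le> N"
  shows "sparse_recovery p s m n A"
  unfolding sparse_recovery_iff_null_space_property[OF p]
proof (intro allI impI ballI)
  fix T z assume T: "T \<subseteq> {..<n}" "real (card T) \<le> s" and z: "z \<in> vecs n" "z \<noteq> (\<lambda>_. 0)"
    and Az: "\<forall>i<m. (\<Sum>j<n. A (i, j) * z j) = 0"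
  show "(\<Sum>i\<in>T. \<bar>z i\<bar> powr p) < (\<Sum>i\<in>{..<n} - T. \<bar>z i\<bar> powr p)"
  proof (rule ccontr)
    assume "\<not> ?thesis"
    then obtain U where U: "U \<subseteq> {..<n}" "card U \<le> card T" "(\<Sum>i\<in>{..<n} - U. \<bar>z i\<bar>) \<le> (\<Sum>i\<in>U. \<bar>z i\<bar>)"
      using lp_failure_imp_l1_failure[OF finite_lessThan T(1) p, of z] by (auto simp: not_less)
    have "z = (\<lambda>_. 0)"
    proof (rule l1_null_space_property[OF _ _ N(1) a b L U(1) _ z(1) _ U(3)])
      fix w :: "nat \<Rightarrow> real" assume w: "\<And>j. w j \<in> {-1, 0, 1}"
      have "quad m n A (restrict w {..<n}) \<le> a * (\<Sum>j<n. (restrict w {..<n} j)\<^sup>2)"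
        using w by (intro up) auto
      then show "quad m n A w \<le> a * (\<Sum>j<n. (w j)\<^sup>2)"
        using quad_cong[of n "restrict w {..<n}" w] by simp
    next
      fix v :: "nat \<Rightarrow> real" assume v: "\<And>j. v j \<in> \<int>" "(\<Sum>j<n. \<bar>v j\<bar>) \<le> N"
      define u where "u = restrict (\<lambda>j. \<lfloor>v j\<rfloor>) {..<n}"
      have u: "real_of_int (u j) = v j" if "j < n" for j
        using v(1)[of j] that by (auto simp: u_def elim!: Ints_cases)
      have "u j \<in> {- int k..int k}" if "j < n" for j
      proof -
        have "\<bar>v j\<bar> \<le> (\<Sum>j<n. \<bar>v j\<bar>)" using that by (intro member_le_sum) auto
        then have "\<bar>real_of_int (u j)\<bar> \<le> real_of_int (int k)" using v N u[OF that] by simp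
        then show ?thesis by (simp only: of_int_abs[symmetric] of_int_le_iff) auto
      qed
      then have "u \<in> {..<n} \<rightarrow>\<^sub>E {- int k..int k}" by (auto simp: u_def)
      moreover have "(\<Sum>j<n. \<bar>real_of_int (u j)\<bar>) \<le> N" using v u by simp
      ultimately have "b * (\<Sum>j<n. (real_of_int (u j))\<^sup>2) \<le> quad m n A (\<lambda>j. real_of_int (u j))"
        by (rule low)
      then show "b * (\<Sum>j<n. (v j)\<^sup>2) \<le> quad m n A v"
        using quad_cong[of n "\<lambda>j. real_of_int (u j)" v] u by simp
    next
      have "real (card U) * L \<le> s * L" using U T L by (intro mult_right_mono) auto
      then show "real (card U) * L \<le> N" using s by linarith
    qed (use Az in auto)
    with z show False by simp
  qed
qed

theorem theorem7:
  fixes \<alpha> p :: real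
  assumes "0 < \<alpha>" "\<alpha> < 1" "0 < p" "p \<le> 1"
  shows "\<exists>\<rho> c. \<rho> > 0 \<and> c > 0 \<and>
    (\<exists>N. \<forall>n\<ge>N.
       measure (gaussian_matrix (nat \<lfloor>\<alpha> * real n\<rfloor>) n)
         {A \<in> space (gaussian_matrix (nat \<lfloor>\<alpha> * real n\<rfloor>) n).
            sparse_recovery p (\<rho> * real n) (nat \<lfloor>\<alpha> * real n\<rfloor>) n A}
       \<ge> 1 - exp (- c * real n))"
proof -
  \<comment> \<open>For large n, \<open>m\<close> is at least \<alpha> n / 2, so
    \<open>(1 / 2) ^ m\<close> is at most exp(-\<beta> n); this is the budget for the constants
    below.\<close>
  define \<beta> where "\<beta> = \<alpha> * ln 2 / 2"
  have "\<alpha> * ln 2 \<le> 1 * 1" using assms ln_2_less_1 by (intro mult_mono) auto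
  then have \<beta>: "0 < \<beta>" "\<beta> \<le> 1 / 2" using assms by (auto simp: \<beta>_def)
  \<comment> \<open>With \<open>t\<close> = \<beta> n / 6 this makes \<open>t * (L / 8 - 1)\<close>
    equal to 8 n + \<beta> n / 6, just above the constant 8 n for sign vectors.\<close>
  define L where "L = 8 * (2 + 48 / \<beta>)"
  \<comment> \<open>The lattice count costs exp(\<beta> n / 8) through \<open>4 * q * n\<close> and,
    by the choice of \<gamma>, again exp(\<beta> n / 8) through \<open>q powr (- N)\<close>;
    \<open>t\<close> costs exp(\<beta> n / 4). Half of the budget remains.\<close>
  define q where "q = \<beta> / 32"
  have q: "0 < q" "q \<le> 1 / 2" "q < 1" using \<beta> by (auto simp: q_def)
  define \<gamma> where "\<gamma> = \<beta> / (8 * - ln q)"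
  have lnq: "0 < - ln q" using q by simp
  have \<gamma>: "0 < \<gamma>" unfolding \<gamma>_def using lnq \<beta> by (intro divide_pos_pos mult_pos_pos) auto
  have L: "0 < L" using \<beta> by (simp add: L_def add_pos_pos)
  show ?thesis
  proof (rule exI[of _ "\<gamma> / L"], rule exI[of _ "\<beta> / 4"],
      \<comment> \<open>The term 2 / \<alpha> lets the floor lose at most half of \<alpha> n; 4 /
        \<beta> lets the factor 2 from the two events be absorbed by halving the exponent.\<close>
      intro conjI exI[of _ "nat \<lceil>2 / \<alpha> + 4 / \<beta>\<rceil>"] allI impI)
    fix n assume "nat \<lceil>2 / \<alpha> + 4 / \<beta>\<rceil> \<le> n"
    then have "2 / \<alpha> + 4 / \<beta> \<le> real n" by linarith
    moreover have "0 < 2 / \<alpha>" "0 < 4 / \<beta>" using assms \<beta> by simp_all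
    ultimately have n: "2 / \<alpha> \<le> real n" "4 / \<beta> \<le> real n" "0 < real n" by linarith+
    define m where "m = nat \<lfloor>\<alpha> * real n\<rfloor>"
    define N where "N = \<gamma> * real n"
    define k where "k = nat \<lceil>N\<rceil>"
    define t where "t = \<beta> / 6 * real n"
    let ?M = "gaussian_matrix m n"
    interpret prob_space ?M by (rule prob_space_gaussian_matrix)
    have N: "0 < N" "N \<le> real k" using \<gamma> n by (auto simp: N_def k_def)
    have "\<alpha> * real n \<le> real n" using assms n by simp
    then have mn: "m \<le> n" unfolding m_def by linarith
    have "2 \<le> \<alpha> * real n" using n(1) assms by (simp add: field_simps)
    then have m: "\<alpha> * real n / 2 \<le> real m" unfolding m_def by linarith
    define V where "V = (\<lambda>v j. real_of_int (v j)) ` {v \<in> {..<n} \<rightarrow>\<^sub>E {- int k..int k}. (\<Sum>j<n. \<bar>real_of_int (v j)\<bar>) \<le> N}"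
    have fin: "finite V" unfolding V_def
      by (intro finite_imageI finite_subset[OF _ finite_PiE[of "{..<n}" "\<lambda>_. {- int k..int k}"]]) auto
    define B1 where "B1 = {A \<in> space ?M. \<exists>w\<in>{..<n} \<rightarrow>\<^sub>E {-1, 0, 1}. 8 * real n * (\<Sum>j<n. (w j)\<^sup>2) < quad m n A w}"
    define B2 where "B2 = {A \<in> space ?M. \<exists>v\<in>V. quad m n A v < t * (\<Sum>j<n. (v j)\<^sup>2)}"
    define G where "G = {A \<in> space ?M. sparse_recovery p (\<gamma> / L * real n) m n A}"
    have B[measurable]: "B1 \<in> sets ?M" "B2 \<in> sets ?M"
    proof -
      have "B1 = (\<Union>w\<in>{..<n} \<rightarrow>\<^sub>E {-1, 0, 1}. {A \<in> space ?M. 8 * real n * (\<Sum>j<n. (w j)\<^sup>2) < quad m n A w})"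
        by (auto simp: B1_def)
      also have "\<dots> \<in> sets ?M" by (intro sets.finite_UN finite_PiE) auto
      finally show "B1 \<in> sets ?M" .
      have "B2 = (\<Union>v\<in>V. {A \<in> space ?M. quad m n A v < t * (\<Sum>j<n. (v j)\<^sup>2)})"
        by (auto simp: B2_def)
      also have "\<dots> \<in> sets ?M" using fin by (intro sets.finite_UN) auto
      finally show "B2 \<in> sets ?M" .
    qed
    have G: "G \<in> sets ?M" unfolding G_def using assms by (intro measurable_sparse_recovery)
    have "A \<in> G" if A: "A \<in> space ?M" "A \<notin> B1" "A \<notin> B2" for A
    proof -
      have "sparse_recovery p (\<gamma> / L * real n) m n A"
      proof (rule sparse_recovery_if_lattice_bounds[OF assms(3,4) _ _ N _ _ L])
        show "quad m n A w \<le> 8 * real n * (\<Sum>j<n. (w j)\<^sup>2)" if "w \<in> {..<n} \<rightarrow>\<^sub>E {-1, 0, 1}" for w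
          using A that unfolding B1_def by (simp add: not_less)
        show "t * (\<Sum>j<n. (real_of_int (v j))\<^sup>2) \<le> quad m n A (\<lambda>j. real_of_int (v j))"
          if "v \<in> {..<n} \<rightarrow>\<^sub>E {- int k..int k}" "(\<Sum>j<n. \<bar>real_of_int (v j)\<bar>) \<le> N" for v
        proof -
          have "(\<lambda>j. real_of_int (v j)) \<in> V" using that by (auto simp: V_def)
          with A show ?thesis unfolding B2_def by (simp add: not_less)
        qed
        show "0 < t" using \<beta> n by (simp add: t_def)
        have "t * (L / 8 - 1) = real n * (\<beta> / 6 + 8)"
          using \<beta> by (simp add: t_def L_def field_simps)
        then show "8 * real n < t * (L / 8 - 1)" using \<beta> n by (simp add: field_simps)
        show "\<gamma> / L * real n * L \<le> N" using L by (simp add: N_def)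
      qed simp
      with A show ?thesis by (simp add: G_def)
    qed
    then have "space ?M - (B1 \<union> B2) \<subseteq> G" by auto
    then have "prob (space ?M - (B1 \<union> B2)) \<le> prob G" by (intro finite_measure_mono G)
    moreover have "prob (space ?M - (B1 \<union> B2)) = 1 - prob (B1 \<union> B2)" by (intro prob_compl) auto
    moreover have "prob (B1 \<union> B2) \<le> prob B1 + prob B2" by (intro measure_Un_le B)
    moreover have "prob B1 \<le> exp (- (\<beta> / 2 * real n))"
    proof -
      have "\<beta> / 2 * real n \<le> 1 * real n" using \<beta> by (intro mult_right_mono) auto
      then show ?thesis using prob_sign_vectors_failure[OF mn] unfolding B1_def by (smt (verit) exp_le_cancel_iff)
    qed
    moreover have "prob B2 \<le> exp (- (\<beta> / 2 * real n))"
    proof -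
      have "prob B2 \<le> q powr (- N) * exp (4 * q * real n) * (exp (3 / 2 * t) * (1 / 2) ^ m)"
        unfolding B2_def by (rule prob_lattice_vectors_failure[OF q(1,2) V_def])
      also have "q powr (- N) = exp (\<beta> / 8 * real n)"
        using q lnq by (simp add: powr_def N_def \<gamma>_def)
      also have "(1 / 2 :: real) ^ m = exp (- (real m * ln 2))"
        by (simp add: exp_minus exp_of_nat_mult power_one_over inverse_eq_divide)
      also have "exp (\<beta> / 8 * real n) * exp (4 * q * real n) * (exp (3 / 2 * t) * exp (- (real m * ln 2)))
          = exp (\<beta> / 2 * real n - real m * ln 2)"
        by (simp add: q_def t_def field_simps flip: exp_add)
      also have "\<dots> \<le> exp (- (\<beta> / 2 * real n))"
        using mult_right_mono[OF m, of "ln 2"] by (simp add: \<beta>_def field_simps)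
      finally show ?thesis .
    qed
    moreover have "2 * exp (- (\<beta> / 2 * real n)) \<le> exp (- (\<beta> / 4 * real n))"
    proof -
      have "1 \<le> \<beta> / 4 * real n" using n(2) \<beta> by (simp add: field_simps)
      then have "2 \<le> exp (\<beta> / 4 * real n)" using exp_ge_add_one_self[of "\<beta> / 4 * real n"] by linarith
      then have "2 * exp (- (\<beta> / 2 * real n)) \<le> exp (\<beta> / 4 * real n) * exp (- (\<beta> / 2 * real n))"
        by (intro mult_right_mono) auto
      also have "\<dots> = exp (- (\<beta> / 4 * real n))" by (simp flip: exp_add)
      finally show ?thesis .
    qed
    ultimately have "1 - exp (- (\<beta> / 4) * real n) \<le> prob G" by simp
    then show "1 - exp (- (\<beta> / 4) * real n) \<le> measure (gaussian_matrix (nat \<lfloor>\<alpha> * real n\<rfloor>) n)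
         {A \<in> space (gaussian_matrix (nat \<lfloor>\<alpha> * real n\<rfloor>) n).
            sparse_recovery p (\<gamma> / L * real n) (nat \<lfloor>\<alpha> * real n\<rfloor>) n A}"
      by (simp add: G_def m_def)
  qed (use \<gamma> L \<beta> in auto)
qed

end
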